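(* Let $(A,\sigma)$ be a state-morphism BL-algebra with $\sigma$ radical-faithful. Then $A$ is a local BL-algebra if and only if $\sigma(A)$ is a local BL-algebra.
   Context: A BL-algebra is an algebra $(A,\wedge,\vee,\odot,\to,0,1)$ of type $(2,2,2,2,0,0)$ such that $(A,\wedge,\vee,0,1)$ is a bounded lattice, $(A,\odot,1)$ is a commutative monoid, and for all $a,b,c\in A$: $c\le a\to b$ iff $a\odot c\le b$; $a\wedge b=a\odot(a\to b)$; $(a\to b)\vee(b\to a)=1$. A morphism-state-operator on $A$ is a map $\sigma:A\to A$ such that for all $x,y\in A$: $\sigma(0)=0$; $\sigma(x\to y)=\sigma(x)\to\sigma(x\wedge y)$; $\sigma(\sigma(x)\odot\sigma(y))=\sigma(x)\odot\sigma(y)$; $\sigma(\sigma(x)\to\sigma(y))=\sigma(x)\to\sigma(y)$; $\sigma(x\odot y)=\sigma(x)\odot\sigma(y)$; then $(A,\sigma)$ is a state-morphism BL-algebra. The image $\sigma(A)$ is a subalgebra of $A$, regarded as a BL-algebra. A filter is a nonempty subset closed under $\odot$ and upward closed; a maximal filter is a proper filter not strictly contained in another proper filter; $\mathrm{Rad}(A)$ is the intersection of all maximal filters of $A$. A BL-algebra is local if it has exactly one maximal filter. $\sigma$ is radical-faithful if for every $x\in A$, $\sigma(x)\in\mathrm{Rad}(A)$ implies $x\in\mathrm{Rad}(A)$. *)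

theory Defs
  imports "HOL-Algebra.Group"
begin

(* BL-algebras are carrier-based structures, so that the image of a state-morphism can
   be regarded as a BL-algebra with the operations inherited from the ambient one.
   The monoid part (mult, one) is HOL-Algebra's record; the lattice operations get bold
   symbols because HOL-Algebra already uses the square ones for lattices given by an order. *)

record 'a bl_struct = "'a monoid" +
  bl_meet :: "['a, 'a] \<Rightarrow> 'a" (infixl "\<^bold>\<and>\<index>" 70)
  bl_join :: "['a, 'a] \<Rightarrow> 'a" (infixl "\<^bold>\<or>\<index>" 65)
  bl_imp  :: "['a, 'a] \<Rightarrow> 'a" (infixr "\<^bold>\<rightarrow>\<index>" 60)
  bl_zero :: 'a ("\<^bold>0\<index>")

definition bl_le :: "('a, 'm) bl_struct_scheme \<Rightarrow> 'a \<Rightarrow> 'a \<Rightarrow> bool" (infix "\<preceq>\<index>" 50)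
  where "a \<preceq>\<^bsub>A\<^esub> b \<longleftrightarrow> a \<^bold>\<and>\<^bsub>A\<^esub> b = a"

(* The one-element algebra (zero = one) is allowed. *)
locale bl_algebra = comm_monoid A for A (structure) +
  assumes meet_closed [intro, simp]:
      "\<lbrakk>a \<in> carrier A; b \<in> carrier A\<rbrakk> \<Longrightarrow> a \<^bold>\<and> b \<in> carrier A"
    and join_closed [intro, simp]:
      "\<lbrakk>a \<in> carrier A; b \<in> carrier A\<rbrakk> \<Longrightarrow> a \<^bold>\<or> b \<in> carrier A"
    and imp_closed [intro, simp]:
      "\<lbrakk>a \<in> carrier A; b \<in> carrier A\<rbrakk> \<Longrightarrow> a \<^bold>\<rightarrow> b \<in> carrier A"
    and zero_closed [intro, simp]: "\<^bold>0 \<in> carrier A"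
    and meet_comm: "\<lbrakk>a \<in> carrier A; b \<in> carrier A\<rbrakk> \<Longrightarrow> a \<^bold>\<and> b = b \<^bold>\<and> a"
    and join_comm: "\<lbrakk>a \<in> carrier A; b \<in> carrier A\<rbrakk> \<Longrightarrow> a \<^bold>\<or> b = b \<^bold>\<or> a"
    and meet_assoc: "\<lbrakk>a \<in> carrier A; b \<in> carrier A; c \<in> carrier A\<rbrakk>
      \<Longrightarrow> (a \<^bold>\<and> b) \<^bold>\<and> c = a \<^bold>\<and> (b \<^bold>\<and> c)"
    and join_assoc: "\<lbrakk>a \<in> carrier A; b \<in> carrier A; c \<in> carrier A\<rbrakk>
      \<Longrightarrow> (a \<^bold>\<or> b) \<^bold>\<or> c = a \<^bold>\<or> (b \<^bold>\<or> c)"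
    and meet_join_absorb: "\<lbrakk>a \<in> carrier A; b \<in> carrier A\<rbrakk> \<Longrightarrow> a \<^bold>\<and> (a \<^bold>\<or> b) = a"
    and join_meet_absorb: "\<lbrakk>a \<in> carrier A; b \<in> carrier A\<rbrakk> \<Longrightarrow> a \<^bold>\<or> (a \<^bold>\<and> b) = a"
    and zero_least: "a \<in> carrier A \<Longrightarrow> \<^bold>0 \<preceq> a"
    and one_greatest: "a \<in> carrier A \<Longrightarrow> a \<preceq> \<one>"
    and residuation: "\<lbrakk>a \<in> carrier A; b \<in> carrier A; c \<in> carrier A\<rbrakk>
      \<Longrightarrow> c \<preceq> a \<^bold>\<rightarrow> b \<longleftrightarrow> a \<otimes> c \<preceq> b"
    and divisibility: "\<lbrakk>a \<in> carrier A; b \<in> carrier A\<rbrakk> \<Longrightarrow> a \<^bold>\<and> b = a \<otimes> (a \<^bold>\<rightarrow> b)"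
    and prelinearity: "\<lbrakk>a \<in> carrier A; b \<in> carrier A\<rbrakk>
      \<Longrightarrow> (a \<^bold>\<rightarrow> b) \<^bold>\<or> (b \<^bold>\<rightarrow> a) = \<one>"

locale state_morphism_bl_algebra = bl_algebra A for A (structure) +
  fixes \<sigma> :: "'a \<Rightarrow> 'a"
  assumes sigma_closed [intro, simp]: "x \<in> carrier A \<Longrightarrow> \<sigma> x \<in> carrier A"
    and sigma_zero: "\<sigma> \<^bold>0 = \<^bold>0"
    and sigma_imp: "\<lbrakk>x \<in> carrier A; y \<in> carrier A\<rbrakk>
      \<Longrightarrow> \<sigma> (x \<^bold>\<rightarrow> y) = \<sigma> x \<^bold>\<rightarrow> \<sigma> (x \<^bold>\<and> y)"
    and sigma_sigma_mult: "\<lbrakk>x \<in> carrier A; y \<in> carrier A\<rbrakk>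
      \<Longrightarrow> \<sigma> (\<sigma> x \<otimes> \<sigma> y) = \<sigma> x \<otimes> \<sigma> y"
    and sigma_sigma_imp: "\<lbrakk>x \<in> carrier A; y \<in> carrier A\<rbrakk>
      \<Longrightarrow> \<sigma> (\<sigma> x \<^bold>\<rightarrow> \<sigma> y) = \<sigma> x \<^bold>\<rightarrow> \<sigma> y"
    and sigma_mult: "\<lbrakk>x \<in> carrier A; y \<in> carrier A\<rbrakk> \<Longrightarrow> \<sigma> (x \<otimes> y) = \<sigma> x \<otimes> \<sigma> y"

definition bl_filter :: "('a, 'm) bl_struct_scheme \<Rightarrow> 'a set \<Rightarrow> bool"
  where "bl_filter A F \<longleftrightarrow>
    F \<subseteq> carrier A \<and> F \<noteq> {} \<and>
    (\<forall>x\<in>F. \<forall>y\<in>F. x \<otimes>\<^bsub>A\<^esub> y \<in> F) \<and>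
    (\<forall>x\<in>F. \<forall>y\<in>carrier A. x \<preceq>\<^bsub>A\<^esub> y \<longrightarrow> y \<in> F)"

definition proper_bl_filter :: "('a, 'm) bl_struct_scheme \<Rightarrow> 'a set \<Rightarrow> bool"
  where "proper_bl_filter A F \<longleftrightarrow> bl_filter A F \<and> F \<noteq> carrier A"

definition maximal_bl_filter :: "('a, 'm) bl_struct_scheme \<Rightarrow> 'a set \<Rightarrow> bool"
  where "maximal_bl_filter A M \<longleftrightarrow>
    proper_bl_filter A M \<and> \<not> (\<exists>F. proper_bl_filter A F \<and> M \<subset> F)"

(* Taken inside the carrier: the empty intersection (one-element algebra) is the carrier. *)
definition bl_Rad :: "('a, 'm) bl_struct_scheme \<Rightarrow> 'a set"
  where "bl_Rad A = {x \<in> carrier A. \<forall>M. maximal_bl_filter A M \<longrightarrow> x \<in> M}"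

locale local_bl_algebra = bl_algebra A for A (structure) +
  assumes unique_maximal: "\<exists>!M. maximal_bl_filter A M"

definition radical_faithful :: "('a, 'm) bl_struct_scheme \<Rightarrow> ('a \<Rightarrow> 'a) \<Rightarrow> bool"
  where "radical_faithful A \<sigma> \<longleftrightarrow>
    (\<forall>x\<in>carrier A. \<sigma> x \<in> bl_Rad A \<longrightarrow> x \<in> bl_Rad A)"

definition image_algebra ::
    "('a, 'm) bl_struct_scheme \<Rightarrow> ('a \<Rightarrow> 'a) \<Rightarrow> ('a, 'm) bl_struct_scheme"
  where "image_algebra A \<sigma> = A\<lparr>carrier := \<sigma> ` carrier A\<rparr>"

end

theory Submission
  imports Defs
begin

text \<open>
  A nontrivial BL-algebra is local iff the set of elements none of whose powers is zero is closed
  under multiplication: that set contains every proper filter, and every element of it lies in a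
  maximal one. In this form locality passes to the subalgebra \<open>\<sigma>(A)\<close>, since powers are computed as
  in \<open>A\<close>. For the converse it suffices that \<open>\<sigma>\<close> preserves having no zero power. If
  \<open>\<sigma>(x)\<^sup>n = 0\<close>, then \<open>\<sigma>\<close> maps the negation of \<open>x\<^sup>n\<close> to \<open>1\<close>, so by radical-faithfulness this negation
  lies in every maximal filter, and hence \<open>x\<close> lies in none.
\<close>

section \<open>Order, residuation and subalgebras\<close>

context bl_algebra
begin

lemma le_trans:
  assumes "a \<preceq> b" "b \<preceq> c" "a \<in> carrier A" "b \<in> carrier A" "c \<in> carrier A"
  shows "a \<preceq> c"
  using assms meet_assoc[of a b c] by (simp add: bl_le_def)

lemma le_antisym:
  assumes "a \<preceq> b" "b \<preceq> a" "a \<in> carrier A" "b \<in> carrier A"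
  shows "a = b"
  using assms meet_comm[of a b] by (simp add: bl_le_def)

lemma le_iff_join:
  assumes "a \<in> carrier A" "b \<in> carrier A"
  shows "a \<preceq> b \<longleftrightarrow> a \<^bold>\<or> b = b"
proof
  assume "a \<preceq> b"
  then show "a \<^bold>\<or> b = b"
    using join_meet_absorb[of b a] assms by (metis bl_le_def join_comm meet_comm)
next
  assume "a \<^bold>\<or> b = b"
  then show "a \<preceq> b"
    using meet_join_absorb[of a b] assms by (simp add: bl_le_def)
qed

lemma le_refl: "a \<in> carrier A \<Longrightarrow> a \<preceq> a"
  using meet_join_absorb[of a "a \<^bold>\<and> a"] by (simp add: bl_le_def join_meet_absorb)

lemma join_upper1: "\<lbrakk>a \<in> carrier A; b \<in> carrier A\<rbrakk> \<Longrightarrow> a \<preceq> a \<^bold>\<or> b"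
  by (simp add: bl_le_def meet_join_absorb)

lemma join_upper2: "\<lbrakk>a \<in> carrier A; b \<in> carrier A\<rbrakk> \<Longrightarrow> b \<preceq> a \<^bold>\<or> b"
  by (metis join_comm join_upper1)

lemma join_least:
  assumes "a \<preceq> c" "b \<preceq> c" "a \<in> carrier A" "b \<in> carrier A" "c \<in> carrier A"
  shows "a \<^bold>\<or> b \<preceq> c"
  using assms join_assoc[of a b c] by (simp add: le_iff_join)

lemma meet_lower1: "\<lbrakk>a \<in> carrier A; b \<in> carrier A\<rbrakk> \<Longrightarrow> a \<^bold>\<and> b \<preceq> a"
  by (metis join_meet_absorb join_comm le_iff_join meet_closed)

lemma meet_lower2: "\<lbrakk>a \<in> carrier A; b \<in> carrier A\<rbrakk> \<Longrightarrow> a \<^bold>\<and> b \<preceq> b"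
  by (metis meet_comm meet_lower1)

lemma meet_greatest:
  assumes "c \<preceq> a" "c \<preceq> b" "a \<in> carrier A" "b \<in> carrier A" "c \<in> carrier A"
  shows "c \<preceq> a \<^bold>\<and> b"
  using assms meet_assoc[of c a b] by (simp add: bl_le_def)

lemma mult_imp_le: "\<lbrakk>a \<in> carrier A; b \<in> carrier A\<rbrakk> \<Longrightarrow> a \<otimes> (a \<^bold>\<rightarrow> b) \<preceq> b"
  by (metis divisibility meet_lower2)

text \<open>Monotonicity comes from residuation: \<open>c\<close> lies below
  \<open>a \<rightarrow> a \<otimes> c\<close>, hence so does \<open>b\<close>.\<close>

lemma mult_mono_right:
  assumes "b \<preceq> c" "a \<in> carrier A" "b \<in> carrier A" "c \<in> carrier A"
  shows "a \<otimes> b \<preceq> a \<otimes> c"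
proof -
  have "c \<preceq> a \<^bold>\<rightarrow> a \<otimes> c"
    using assms by (simp add: residuation le_refl)
  then have "b \<preceq> a \<^bold>\<rightarrow> a \<otimes> c"
    using assms le_trans[of b c] by simp
  then show ?thesis
    using assms by (simp add: residuation)
qed

lemma mult_mono:
  assumes "a \<preceq> b" "c \<preceq> d"
    and "a \<in> carrier A" "b \<in> carrier A" "c \<in> carrier A" "d \<in> carrier A"
  shows "a \<otimes> c \<preceq> b \<otimes> d"
  using assms mult_mono_right[of a b c] mult_mono_right[of c d b] le_trans[of "a \<otimes> c" "b \<otimes> c"]
  by (simp add: m_comm)

lemma le_zero_iff: "a \<in> carrier A \<Longrightarrow> a \<preceq> \<^bold>0 \<longleftrightarrow> a = \<^bold>0"
  using le_antisym le_refl zero_least by blast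

lemma imp_self: "a \<in> carrier A \<Longrightarrow> a \<^bold>\<rightarrow> a = \<one>"
  using residuation[of a a \<one>] one_greatest le_antisym by (simp add: le_refl)

lemma meet_zero: "a \<in> carrier A \<Longrightarrow> a \<^bold>\<and> \<^bold>0 = \<^bold>0"
  using zero_least[of a] meet_comm[of a "\<^bold>0"] by (simp add: bl_le_def)

text \<open>This expresses the join by meet and implication, so that a subset closed under the
  latter two is closed under joins. For the nontrivial inequality, residuation puts both
  \<open>a \<rightarrow> b\<close> and \<open>b \<rightarrow> a\<close> below the implication from
  the right-hand side to \<open>a \<or> b\<close>; by prelinearity their join is 1, so that
  implication is 1.\<close>

lemma join_eq_meet_imp:
  assumes a: "a \<in> carrier A" and b: "b \<in> carrier A"
  shows "a \<^bold>\<or> b = ((a \<^bold>\<rightarrow> b) \<^bold>\<rightarrow> b) \<^bold>\<and> ((b \<^bold>\<rightarrow> a) \<^bold>\<rightarrow> a)" (is "_ = ?t")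
proof (rule le_antisym)
  \<comment> \<open>The bound on \<open>c\<close> is modus ponens under residuation; the bound on
    \<open>d\<close> holds because multiplying \<open>d\<close> by anything only decreases
    it.\<close>
  have upper: "c \<preceq> (c \<^bold>\<rightarrow> d) \<^bold>\<rightarrow> d \<and> d \<preceq> (c \<^bold>\<rightarrow> d) \<^bold>\<rightarrow> d"
    if "c \<in> carrier A" "d \<in> carrier A" for c d
    using that mult_imp_le[of c d] mult_mono[OF one_greatest le_refl, of "c \<^bold>\<rightarrow> d" d]
    by (simp add: residuation m_comm)
  show "a \<^bold>\<or> b \<preceq> ?t"
    using upper[OF a b] upper[OF b a] a b by (intro join_least meet_greatest) auto
  have "?t \<otimes> (a \<^bold>\<rightarrow> b) \<preceq> b"
    using a b meet_lower1[of "(a \<^bold>\<rightarrow> b) \<^bold>\<rightarrow> b" "(b \<^bold>\<rightarrow> a) \<^bold>\<rightarrow> a"]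
    by (simp add: residuation m_comm)
  then have 1: "a \<^bold>\<rightarrow> b \<preceq> ?t \<^bold>\<rightarrow> (a \<^bold>\<or> b)"
    using a b le_trans[OF _ join_upper2[OF a b], of "?t \<otimes> (a \<^bold>\<rightarrow> b)"] by (simp add: residuation)
  have "?t \<otimes> (b \<^bold>\<rightarrow> a) \<preceq> a"
    using a b meet_lower2[of "(a \<^bold>\<rightarrow> b) \<^bold>\<rightarrow> b" "(b \<^bold>\<rightarrow> a) \<^bold>\<rightarrow> a"]
    by (simp add: residuation m_comm)
  then have 2: "b \<^bold>\<rightarrow> a \<preceq> ?t \<^bold>\<rightarrow> (a \<^bold>\<or> b)"
    using a b le_trans[OF _ join_upper1[OF a b], of "?t \<otimes> (b \<^bold>\<rightarrow> a)"] by (simp add: residuation)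
  have "\<one> \<preceq> ?t \<^bold>\<rightarrow> (a \<^bold>\<or> b)"
    using join_least[OF 1 2] a b by (simp add: prelinearity)
  then show "?t \<preceq> a \<^bold>\<or> b"
    using a b by (simp add: residuation)
qed (use a b in auto)

text \<open>Meets stay in \<open>S\<close> by divisibility and joins by
  \<open>join_eq_meet_imp\<close>. The other axioms are inherited, since the operations, and hence
  the order, are unchanged.\<close>

lemma bl_subalgebra:
  assumes sub: "S \<subseteq> carrier A"
    and zero: "\<^bold>0 \<in> S" and one: "\<one> \<in> S"
    and mult: "\<And>a b. \<lbrakk>a \<in> S; b \<in> S\<rbrakk> \<Longrightarrow> a \<otimes> b \<in> S"
    and imp: "\<And>a b. \<lbrakk>a \<in> S; b \<in> S\<rbrakk> \<Longrightarrow> a \<^bold>\<rightarrow> b \<in> S"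
  shows "bl_algebra (A\<lparr>carrier := S\<rparr>)"
proof -
  have in_A: "a \<in> carrier A" if "a \<in> S" for a
    using sub that by auto
  have meet: "a \<^bold>\<and> b \<in> S" if "a \<in> S" "b \<in> S" for a b
    using that by (simp add: in_A divisibility mult imp)
  have join: "a \<^bold>\<or> b \<in> S" if "a \<in> S" "b \<in> S" for a b
    using that by (simp add: in_A join_eq_meet_imp meet imp)
  have le: "x \<preceq>\<^bsub>A\<lparr>carrier := S\<rparr>\<^esub> y \<longleftrightarrow> x \<preceq> y" for x y
    by (simp add: bl_le_def)
  show ?thesis
    by (unfold_locales; simp add: in_A meet join zero one mult imp le;
        (rule m_assoc m_comm meet_comm join_comm meet_assoc join_assoc meet_join_absorb
          join_meet_absorb zero_least one_greatest residuation divisibility prelinearity;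
          simp add: in_A)?)
qed

section \<open>Filters and the existence of maximal filters\<close>

lemma filter_one: "bl_filter A F \<Longrightarrow> \<one> \<in> F"
  unfolding bl_filter_def using one_greatest by blast

lemma filter_pow: "\<lbrakk>bl_filter A F; x \<in> F\<rbrakk> \<Longrightarrow> x [^] (n::nat) \<in> F"
  by (induction n) (simp add: filter_one, simp add: bl_filter_def)

lemma proper_filter_iff: "proper_bl_filter A F \<longleftrightarrow> bl_filter A F \<and> \<^bold>0 \<notin> F"
  unfolding proper_bl_filter_def bl_filter_def using zero_least by blast

text \<open>Zorn's lemma: being proper means omitting 0, a property that passes to unions of
  chains.\<close>

lemma proper_filter_le_maximal:
  assumes F: "proper_bl_filter A F"
  shows "\<exists>M. maximal_bl_filter A M \<and> F \<subseteq> M"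
proof -
  let ?P = "{G. proper_bl_filter A G \<and> F \<subseteq> G}"
  have "\<exists>M\<in>?P. \<forall>X\<in>?P. M \<subseteq> X \<longrightarrow> X = M"
  proof (rule subset_Zorn_nonempty)
    show "?P \<noteq> {}"
      using F by auto
  next
    fix C assume ne: "C \<noteq> {}" and chain: "subset.chain ?P C"
    then have C: "bl_filter A G" "\<^bold>0 \<notin> G" "F \<subseteq> G" if "G \<in> C" for G
      using that by (auto simp: subset.chain_def proper_filter_iff)
    have "x \<otimes> y \<in> \<Union>C" if "x \<in> \<Union>C" "y \<in> \<Union>C" for x y
    proof -
      obtain G H where "G \<in> C" "x \<in> G" "H \<in> C" "y \<in> H"
        using \<open>x \<in> \<Union>C\<close> \<open>y \<in> \<Union>C\<close> by auto
      moreover have "G \<subseteq> H \<or> H \<subseteq> G"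
        using chain calculation by (auto simp: subset_chain_def)
      ultimately obtain K where "K \<in> C" "x \<in> K" "y \<in> K"
        by auto
      then have "x \<otimes> y \<in> K"
        using C(1)[of K] by (simp add: bl_filter_def)
      then show ?thesis
        using \<open>K \<in> C\<close> by auto
    qed
    moreover have "\<Union>C \<subseteq> carrier A"
      using C(1) by (intro Union_least) (simp add: bl_filter_def)
    moreover have "F \<subseteq> \<Union>C"
      using ne C(3) by blast
    moreover have "F \<noteq> {}"
      using F by (simp add: proper_bl_filter_def bl_filter_def)
    then have "\<Union>C \<noteq> {}"
      using \<open>F \<subseteq> \<Union>C\<close> by blast
    moreover have "y \<in> \<Union>C" if "x \<in> \<Union>C" "y \<in> carrier A" "x \<preceq> y" for x y
    proof -
      obtain G where "G \<in> C" "x \<in> G"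
        using \<open>x \<in> \<Union>C\<close> by auto
      moreover have "y \<in> G"
        using C(1)[OF \<open>G \<in> C\<close>] \<open>x \<in> G\<close> that(2,3) unfolding bl_filter_def by blast
      ultimately show ?thesis
        by auto
    qed
    ultimately have "bl_filter A (\<Union>C)"
      unfolding bl_filter_def by (intro conjI ballI impI)
    then show "\<Union>C \<in> ?P"
      using C(2) \<open>F \<subseteq> \<Union>C\<close> by (auto simp: proper_filter_iff)
  qed
  then obtain M where "M \<in> ?P" and "\<forall>X\<in>?P. M \<subseteq> X \<longrightarrow> X = M" ..
  then show ?thesis
    unfolding maximal_bl_filter_def by blast
qed

end

section \<open>Elements without a zero power, and locality\<close>

definition nonnilpotents :: "('a, 'm) bl_struct_scheme \<Rightarrow> 'a set" where
  "nonnilpotents A = {x \<in> carrier A. \<forall>n::nat. x [^]\<^bsub>A\<^esub> n \<noteq> \<^bold>0\<^bsub>A\<^esub>}"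

context bl_algebra
begin

lemma pow_mono:
  assumes "x \<preceq> y" "x \<in> carrier A" "y \<in> carrier A"
  shows "x [^] (n::nat) \<preceq> y [^] n"
  by (induction n) (use assms in \<open>simp_all add: mult_mono le_refl\<close>)

lemma nonnilpotents_upward:
  assumes "x \<in> nonnilpotents A" "y \<in> carrier A" "x \<preceq> y"
  shows "y \<in> nonnilpotents A"
proof -
  have x: "x \<in> carrier A" "x [^] n \<noteq> \<^bold>0" for n :: nat
    using assms by (auto simp: nonnilpotents_def)
  have "y [^] n \<noteq> \<^bold>0" for n :: nat
    using x pow_mono[of x y n] assms le_zero_iff[of "x [^] n"] by auto
  then show ?thesis
    using assms by (simp add: nonnilpotents_def)
qed

lemma pow_nonnilpotents: "x \<in> nonnilpotents A \<Longrightarrow> x [^] (n::nat) \<in> nonnilpotents A"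
  by (auto simp: nonnilpotents_def nat_pow_pow)

lemma proper_filter_le_nonnilpotents:
  assumes "proper_bl_filter A F"
  shows "F \<subseteq> nonnilpotents A"
proof
  have F: "bl_filter A F" "\<^bold>0 \<notin> F"
    using assms by (simp_all add: proper_filter_iff)
  fix x assume x: "x \<in> F"
  then have "x \<in> carrier A"
    using F(1) unfolding bl_filter_def by blast
  moreover have "x [^] n \<noteq> \<^bold>0" for n :: nat
    using filter_pow[OF F(1) x, of n] F(2) by metis
  ultimately show "x \<in> nonnilpotents A"
    by (simp add: nonnilpotents_def)
qed

lemma nonnilpotents_in_maximal:
  assumes x: "x \<in> nonnilpotents A"
  shows "\<exists>M. maximal_bl_filter A M \<and> x \<in> M"
proof -
  \<comment> \<open>The filter generated by \<open>x\<close>. It is proper because a power of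
    \<open>x\<close> below 0 would equal 0.\<close>
  let ?F = "{y \<in> carrier A. \<exists>n::nat. x [^] n \<preceq> y}"
  have xA: "x \<in> carrier A" and pow: "x [^] n \<noteq> \<^bold>0" for n :: nat
    using x by (auto simp: nonnilpotents_def)
  have x_in: "x \<in> ?F"
    using xA le_refl[of x] by (auto intro!: exI[of _ 1])
  have "y \<otimes> z \<in> ?F" if y: "y \<in> ?F" and z: "z \<in> ?F" for y z
  proof -
    obtain m n :: nat where "x [^] m \<preceq> y" "x [^] n \<preceq> z"
      using y z by auto
    then have "x [^] (m + n) \<preceq> y \<otimes> z"
      using mult_mono[of "x [^] m" y "x [^] n" z] xA y z by (simp add: nat_pow_mult)
    then show ?thesis
      using y z by auto
  qed
  moreover have "z \<in> ?F" if "y \<in> ?F" "z \<in> carrier A" "y \<preceq> z" for y z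
    using that xA le_trans nat_pow_closed by blast
  ultimately have "bl_filter A ?F"
    unfolding bl_filter_def using x_in by blast
  then have "proper_bl_filter A ?F"
    using pow xA by (auto simp: proper_filter_iff le_zero_iff)
  then show ?thesis
    using proper_filter_le_maximal x_in by blast
qed

text \<open>By the two preceding lemmas, \<open>nonnilpotents A\<close> is the union of the maximal
  filters, so it equals a unique one. Conversely, closure under multiplication makes it a proper
  filter containing every proper filter, hence the only maximal one. The condition that 1 differs
  from 0 excludes the one-element algebra, where closure holds vacuously but no maximal filter
  exists.\<close>

lemma local_iff_nonnilpotents:
  "local_bl_algebra A \<longleftrightarrow>
    \<one> \<noteq> \<^bold>0 \<and> (\<forall>x\<in>nonnilpotents A. \<forall>y\<in>nonnilpotents A. x \<otimes> y \<in> nonnilpotents A)"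
  (is "_ \<longleftrightarrow> ?R")
proof
  assume "local_bl_algebra A"
  then obtain M where M: "maximal_bl_filter A M" and uniq: "\<And>N. maximal_bl_filter A N \<Longrightarrow> N = M"
    unfolding local_bl_algebra_def local_bl_algebra_axioms_def by blast
  have proper: "proper_bl_filter A M"
    using M by (simp add: maximal_bl_filter_def)
  have "nonnilpotents A = M"
    using proper_filter_le_nonnilpotents[OF proper] nonnilpotents_in_maximal uniq by blast
  moreover have "bl_filter A M" "\<one> \<noteq> \<^bold>0"
    using proper filter_one by (auto simp: proper_filter_iff)
  ultimately show ?R
    by (simp add: bl_filter_def)
next
  assume R: ?R
  have "\<one> \<in> nonnilpotents A"
    using R by (simp add: nonnilpotents_def)
  moreover have "y \<in> nonnilpotents A"
    if "x \<in> nonnilpotents A" "y \<in> carrier A" "x \<preceq> y" for x y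
    using that nonnilpotents_upward by blast
  moreover have "nonnilpotents A \<subseteq> carrier A"
    by (auto simp: nonnilpotents_def)
  ultimately have "bl_filter A (nonnilpotents A)"
    unfolding bl_filter_def using R by blast
  \<comment> \<open>The exponent 1 is the witness; the exponent 0 would give the power 1.\<close>
  moreover have "\<^bold>0 \<notin> nonnilpotents A"
    by (auto simp: nonnilpotents_def intro: exI[of _ "1::nat"])
  ultimately have "proper_bl_filter A (nonnilpotents A)"
    by (simp add: proper_filter_iff)
  then have "\<exists>!M. maximal_bl_filter A M"
    unfolding maximal_bl_filter_def
    by (intro ex1I[of _ "nonnilpotents A"]) (use proper_filter_le_nonnilpotents in blast)+
  then show "local_bl_algebra A"
    using bl_algebra_axioms by (simp add: local_bl_algebra_def local_bl_algebra_axioms_def)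
qed

text \<open>A maximal filter containing \<open>x\<close> cannot contain its negation as well,
  because their product is 0.\<close>

lemma nonnilpotents_neg_notin_Rad:
  assumes "x \<in> nonnilpotents A"
  shows "x \<^bold>\<rightarrow> \<^bold>0 \<notin> bl_Rad A"
proof
  assume neg: "x \<^bold>\<rightarrow> \<^bold>0 \<in> bl_Rad A"
  obtain M where M: "maximal_bl_filter A M" "x \<in> M"
    using nonnilpotents_in_maximal assms by blast
  then have "bl_filter A M" "\<^bold>0 \<notin> M" "x \<^bold>\<rightarrow> \<^bold>0 \<in> M"
    using neg by (auto simp: maximal_bl_filter_def proper_filter_iff bl_Rad_def)
  moreover have "x \<otimes> (x \<^bold>\<rightarrow> \<^bold>0) = \<^bold>0"
    using assms by (simp add: nonnilpotents_def divisibility[symmetric] meet_zero)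
  ultimately show False
    using M(2) unfolding bl_filter_def by metis
qed

end

section \<open>Locality of the image under a state-morphism\<close>

context state_morphism_bl_algebra
begin

text \<open>Obtained by evaluating \<sigma> at the implication from 0 to 0, which is 1.\<close>

lemma sigma_one: "\<sigma> \<one> = \<one>"
  using sigma_imp[of "\<^bold>0" "\<^bold>0"] by (simp add: imp_self meet_zero sigma_zero)

lemma sigma_pow: "x \<in> carrier A \<Longrightarrow> \<sigma> (x [^] (n::nat)) = \<sigma> x [^] n"
  by (induction n) (auto simp: sigma_one sigma_mult)

text \<open>The meet in the axiom for \<sigma> of an implication collapses here, as a meet with 0 is
  0.\<close>

lemma sigma_neg: "x \<in> carrier A \<Longrightarrow> \<sigma> (x \<^bold>\<rightarrow> \<^bold>0) = \<sigma> x \<^bold>\<rightarrow> \<^bold>0"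
  by (simp add: sigma_imp meet_zero sigma_zero)

text \<open>Products and implications of elements of the image are fixed by \<sigma>, so each is the
  image of itself.\<close>

lemma bl_algebra_image: "bl_algebra (image_algebra A \<sigma>)"
  unfolding image_algebra_def
proof (rule bl_subalgebra)
  show "\<^bold>0 \<in> \<sigma> ` carrier A" "\<one> \<in> \<sigma> ` carrier A"
    using sigma_zero sigma_one by (metis imageI zero_closed, metis imageI one_closed)
  fix a b assume "a \<in> \<sigma> ` carrier A" "b \<in> \<sigma> ` carrier A"
  then obtain x y where "x \<in> carrier A" "y \<in> carrier A" and [simp]: "a = \<sigma> x" "b = \<sigma> y"
    by auto
  then show "a \<otimes> b \<in> \<sigma> ` carrier A" "a \<^bold>\<rightarrow> b \<in> \<sigma> ` carrier A"
    using sigma_sigma_mult[of x y] sigma_sigma_imp[of x y]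
    by (metis \<open>a = \<sigma> x\<close> \<open>b = \<sigma> y\<close> imageI m_closed sigma_closed,
        metis \<open>a = \<sigma> x\<close> \<open>b = \<sigma> y\<close> imageI imp_closed sigma_closed)
qed auto

lemma nonnilpotents_image:
  "nonnilpotents (image_algebra A \<sigma>) = nonnilpotents A \<inter> \<sigma> ` carrier A"
  by (auto simp: nonnilpotents_def image_algebra_def nat_pow_def)

text \<open>Quantifiers over the image are pulled back along \<sigma> to \<open>carrier A\<close>,
  so that the criterion can be compared directly with the one for \<open>A\<close>.\<close>

lemma local_image_iff:
  "local_bl_algebra (image_algebra A \<sigma>) \<longleftrightarrow>
    \<one> \<noteq> \<^bold>0 \<and> (\<forall>x\<in>carrier A. \<forall>y\<in>carrier A.
      \<sigma> x \<in> nonnilpotents A \<and> \<sigma> y \<in> nonnilpotents A \<longrightarrow> \<sigma> (x \<otimes> y) \<in> nonnilpotents A)"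
  unfolding bl_algebra.local_iff_nonnilpotents[OF bl_algebra_image] nonnilpotents_image
  by (simp add: image_algebra_def Ball_def image_iff) (smt (verit) m_closed sigma_mult)

text \<open>\<sigma> commutes with powers and fixes 0, so a zero power of \<open>x\<close> yields
  one of \<open>\<sigma> x\<close>.\<close>

lemma nonnilpotents_if_sigma:
  assumes "x \<in> carrier A" "\<sigma> x \<in> nonnilpotents A"
  shows "x \<in> nonnilpotents A"
  using assms sigma_pow[of x] sigma_zero by (auto simp: nonnilpotents_def) metis

lemma sigma_nonnilpotents:
  assumes rf: "radical_faithful A \<sigma>" and x: "x \<in> nonnilpotents A"
  shows "\<sigma> x \<in> nonnilpotents A"
proof (rule ccontr)
  have xA: "x \<in> carrier A"
    using x by (simp add: nonnilpotents_def)
  assume "\<sigma> x \<notin> nonnilpotents A"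
  then obtain n :: nat where "\<sigma> x [^] n = \<^bold>0"
    using xA by (auto simp: nonnilpotents_def)
  then have "\<sigma> (x [^] n \<^bold>\<rightarrow> \<^bold>0) = \<one>"
    using xA by (simp add: sigma_neg sigma_pow imp_self)
  moreover have "\<one> \<in> bl_Rad A"
    by (auto simp: bl_Rad_def maximal_bl_filter_def proper_bl_filter_def filter_one)
  ultimately have "x [^] n \<^bold>\<rightarrow> \<^bold>0 \<in> bl_Rad A"
    using rf xA by (simp add: radical_faithful_def)
  then show False
    using nonnilpotents_neg_notin_Rad pow_nonnilpotents x by blast
qed

end

theorem theorem7p8:
  fixes A :: "('a, 'm) bl_struct_scheme" and \<sigma> :: "'a \<Rightarrow> 'a"
  assumes "state_morphism_bl_algebra A \<sigma>"
    and "radical_faithful A \<sigma>"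
  shows "local_bl_algebra A \<longleftrightarrow> local_bl_algebra (image_algebra A \<sigma>)"
proof -
  interpret state_morphism_bl_algebra A \<sigma>
    by (fact assms(1))
  have carr: "x \<in> carrier A" if "x \<in> nonnilpotents A" for x
    using that by (simp add: nonnilpotents_def)
  show ?thesis
    unfolding local_iff_nonnilpotents local_image_iff
  proof (intro conj_cong refl iffI ballI impI)
    fix x y
    assume "\<forall>x\<in>nonnilpotents A. \<forall>y\<in>nonnilpotents A. x \<otimes>\<^bsub>A\<^esub> y \<in> nonnilpotents A"
      and "x \<in> carrier A" "y \<in> carrier A" "\<sigma> x \<in> nonnilpotents A \<and> \<sigma> y \<in> nonnilpotents A"
    then show "\<sigma> (x \<otimes>\<^bsub>A\<^esub> y) \<in> nonnilpotents A"
      by (simp add: sigma_mult)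
  next
    fix x y
    assume "\<forall>x\<in>carrier A. \<forall>y\<in>carrier A.
        \<sigma> x \<in> nonnilpotents A \<and> \<sigma> y \<in> nonnilpotents A \<longrightarrow> \<sigma> (x \<otimes>\<^bsub>A\<^esub> y) \<in> nonnilpotents A"
      and "x \<in> nonnilpotents A" "y \<in> nonnilpotents A"
    \<comment> \<open>\<open>\<sigma> x\<close> and \<open>\<sigma> y\<close> have no zero power by
      \<open>sigma_nonnilpotents\<close>, where radical-faithfulness enters. The assumption then
      gives the same for \<open>\<sigma> (x \<otimes> y)\<close>, and this is reflected back to
      \<open>x \<otimes> y\<close>.\<close>
    then show "x \<otimes>\<^bsub>A\<^esub> y \<in> nonnilpotents A"
      using carr sigma_nonnilpotents[OF assms(2)] nonnilpotents_if_sigma[of "x \<otimes>\<^bsub>A\<^esub> y"] by simp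
  qed
qed

end
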